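(* Let $p\ge2$, let $h\in\mathbb{R}^p$ with $h_i\ne0$ for all $i\in[p]$, and let $f:\mathbb{R}\to\mathbb{R}$ be convex with $f(0)=0$. Let $Q_{\mathrm{wh}}=\{z\in\{0,1\}^p: z_p\le\sum_{i\in[p-1]}z_i\}$ and $$Z_{Q_{\mathrm{wh}}}=\left\{(z,\beta,t)\in Q_{\mathrm{wh}}\times\mathbb{R}^p\times\mathbb{R}\;:\; f(h^\top\beta)\le t,\ \beta_i(1-z_i)=0\ \ \forall i\in[p]\right\}.$$ Then $$\operatorname{cl\,conv}(Z_{Q_{\mathrm{wh}}})=\Big\{(z,\beta,t)\in[0,1]^p\times\mathbb{R}^{p}\times\mathbb{R}\;:\; f(h^\top\beta)\le t,\ z_p\le\sum_{i\in[p-1]}z_i,\ \Big(\sum_{i\in[p-1]}z_i\Big)f\Big(\frac{h^\top\beta}{\sum_{i\in[p-1]}z_i}\Big)\le t\Big\}.$$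
   Context: Notation: $[p]=\{1,\dots,p\}$; $\operatorname{cl\,conv}$ is the closure of the convex hull. Convention for perspectives: for $w>0$ the expression $w f(x/w)$ is the usual one, and for $w=0$ it is understood as $0f(x/0):=\lim_{w\to0^+}w f(x/w)\in(-\infty,+\infty]$ (an inequality with left-hand side $+\infty$ is never satisfied by real $t$). *)

theory Defs
  imports "HOL-Analysis.Analysis"
begin

text \<open>
  The index set \<open>{1, \<dots>, p}\<close> is a finite type \<open>'n\<close> with \<open>p = CARD('n)\<close>, and the special index
  \<open>p\<close> is an arbitrary but fixed element \<open>l\<close> of \<open>'n\<close>; the index set \<open>{1, \<dots>, p - 1}\<close>
  is then \<open>UNIV - {l}\<close>.
\<close>

definition Q_wh :: "'n::finite \<Rightarrow> (real ^ 'n) set" where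
  "Q_wh l = {z. (\<forall>i. z $ i \<in> {0, 1}) \<and> z $ l \<le> (\<Sum>i\<in>UNIV - {l}. z $ i)}"

definition Z_set :: "(real \<Rightarrow> real) \<Rightarrow> real ^ 'n \<Rightarrow> (real ^ 'n) set \<Rightarrow>
    ((real ^ 'n) \<times> (real ^ 'n) \<times> real) set" where
  "Z_set f h Q = {(z, \<beta>, t). z \<in> Q \<and> f (h \<bullet> \<beta>) \<le> t \<and> (\<forall>i. \<beta> $ i * (1 - z $ i) = 0)}"

text \<open>
  The perspective \<open>w f(x/w)\<close>, with \<open>0 f(x/0)\<close> the right limit at \<open>w = 0\<close>. For convex \<open>f\<close>
  with \<open>f 0 = 0\<close> the function \<open>w f(x/w)\<close> is nonincreasing in \<open>w > 0\<close>, so this limit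
  exists in the extended reals and is not \<open>-\<infinity>\<close>. Negative \<open>w\<close> does not occur.
\<close>

definition perspective :: "(real \<Rightarrow> real) \<Rightarrow> real \<Rightarrow> real \<Rightarrow> ereal" where
  "perspective f w x =
     (if w = 0 then Lim (at_right 0) (\<lambda>v. ereal (v * f (x / v))) else ereal (w * f (x / w)))"

end

theory Submission
  imports Defs
begin

text \<open>
  Write \<open>w\<close> for the sum of the \<open>z $ i\<close> over \<open>i \<noteq> l\<close> and \<open>x\<close> for \<open>h \<bullet> \<beta>\<close>.

  The right-hand side is closed and convex because the perspective inequality at \<open>(w, x)\<close> with
  \<open>w \<ge> 0\<close> says the same as all the inequalities \<open>(w + e) * f (x / (w + e)) \<le> t\<close> with \<open>e > 0\<close>
  (\<open>perspective_le_iff\<close>), each of which describes a closed convex set. This uses that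
  \<open>v * f (x / v)\<close> is nonincreasing in \<open>v\<close>, a consequence of convexity and \<open>f 0 = 0\<close>. The same
  monotonicity puts the points of the mixed-binary set on the right-hand side: either \<open>w \<ge> 1\<close>, or
  \<open>z = 0\<close> and hence \<open>\<beta> = 0\<close>.

  For the other inclusion, let \<open>C\<close> be the closed convex hull. Since the all-ones vector belongs
  to \<open>Q_wh l\<close> and \<open>f 0 = 0\<close>, every \<open>d\<close> orthogonal to \<open>h\<close> gives a recession direction \<open>(0, d, 0)\<close>
  of \<open>C\<close>. So only the value \<open>h \<bullet> \<beta>\<close> matters, not the support of \<open>\<beta>\<close>, and every nonzero
  \<open>z \<in> Q_wh l\<close> may be combined with every \<open>\<beta>\<close>. The binary points with \<open>w \<ge> 1\<close> have the convex hull
  \<open>{z \<in> [0,1]^p. w \<ge> 1}\<close> (\<open>cover_polytope_subset_hull\<close>), which settles the case \<open>w \<ge> 1\<close>. A point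
  with \<open>0 < w < 1\<close> is the \<open>w\<close>-fold multiple of a point with \<open>w = 1\<close>, so it lies on a segment from
  that point to the origin, and the scaling turns \<open>f x \<le> t\<close> into the perspective inequality. A
  point with \<open>w = 0\<close> is a limit of such points.
\<close>

section \<open>The perspective of a convex function\<close>

lemma perspective_antimono:
  fixes f :: "real \<Rightarrow> real"
  assumes "convex_on UNIV f" "f 0 = 0" "0 < v" "v \<le> w"
  shows "w * f (x / w) \<le> v * f (x / v)"
proof -
  \<comment> \<open>\<open>x / w\<close> is the convex combination of \<open>0\<close> and \<open>x / v\<close> with weight \<open>v / w\<close> on the latter.\<close>
  have "f ((1 - v / w) *\<^sub>R 0 + (v / w) *\<^sub>R (x / v)) \<le> (1 - v / w) * f 0 + (v / w) * f (x / v)"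
    using assms by (intro convex_onD[OF assms(1)]) auto
  then have "f (x / w) \<le> (v / w) * f (x / v)"
    using assms by simp
  then have "w * f (x / w) \<le> w * ((v / w) * f (x / v))"
    using assms by (intro mult_left_mono) auto
  then show ?thesis
    using assms by simp
qed

lemma perspective_convex_combination:
  fixes f :: "real \<Rightarrow> real"
  assumes f: "convex_on UNIV f" and w: "0 < w1" "0 < w2" and ab: "0 \<le> a" "0 \<le> b" "a + b = 1"
  shows "(a * w1 + b * w2) * f ((a * x1 + b * x2) / (a * w1 + b * w2))
    \<le> a * (w1 * f (x1 / w1)) + b * (w2 * f (x2 / w2))"
proof -
  define W where "W = a * w1 + b * w2"
  have W: "0 < W"
    using w ab unfolding W_def
    by (cases "a = 0") (auto intro: add_pos_nonneg)
  define c d where "c = a * w1 / W" and "d = b * w2 / W"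
  have cd: "0 \<le> c" "0 \<le> d" "c + d = 1"
    using W w ab by (auto simp: c_def d_def W_def simp flip: add_divide_distrib)
  have "f (c *\<^sub>R (x1 / w1) + d *\<^sub>R (x2 / w2)) \<le> c * f (x1 / w1) + d * f (x2 / w2)"
    using f cd unfolding convex_on_def by blast
  moreover have "c *\<^sub>R (x1 / w1) + d *\<^sub>R (x2 / w2) = (a * x1 + b * x2) / W"
    using w W by (simp add: c_def d_def field_simps)
  ultimately have "W * f ((a * x1 + b * x2) / W) \<le> W * (c * f (x1 / w1) + d * f (x2 / w2))"
    using W by (simp add: mult_left_mono)
  also have "\<dots> = a * (w1 * f (x1 / w1)) + b * (w2 * f (x2 / w2))"
    using W by (simp add: c_def d_def field_simps)
  finally show ?thesis
    unfolding W_def .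
qed

text \<open>
  By monotonicity the limit at \<open>w = 0\<close> is a supremum; for \<open>w > 0\<close> the perspective at \<open>w\<close> is the
  supremum of its values to the right of \<open>w\<close>, by continuity. Replacing \<open>w\<close> by \<open>w + e\<close> removes the
  singularity at \<open>w = 0\<close>, so closedness and convexity can be read off.
\<close>

lemma perspective_le_iff:
  fixes f :: "real \<Rightarrow> real"
  assumes f: "convex_on UNIV f" "f 0 = 0" and w: "0 \<le> w"
  shows "perspective f w x \<le> ereal t \<longleftrightarrow> (\<forall>e>0. (w + e) * f (x / (w + e)) \<le> t)"
proof (cases "w = 0")
  case True
  define g where "g = (\<lambda>v. ereal (v * f (x / v)))"
  have "(g \<longlongrightarrow> (SUP v\<in>{0<..}. g v)) (at_right 0)"
  proof (rule order_tendstoI)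
    fix a assume "a < (SUP v\<in>{0<..}. g v)"
    then obtain v0 where v0: "0 < v0" "a < g v0"
      by (auto simp: less_SUP_iff)
    have "a < g v" if "0 < v" "v < v0" for v
      using perspective_antimono[OF f that(1), of v0 x] that v0
      by (auto simp: g_def elim!: order_less_le_trans)
    then show "eventually (\<lambda>v. a < g v) (at_right 0)"
      unfolding eventually_at_right_field using v0 by auto
  next
    fix a assume "(SUP v\<in>{0<..}. g v) < a"
    then have "g v < a" if "0 < v" for v
      using that by (meson SUP_upper greaterThan_iff order_le_less_trans)
    then show "eventually (\<lambda>v. g v < a) (at_right 0)"
      unfolding eventually_at_right_field by (auto intro: exI[of _ 1])
  qed
  then have "Lim (at_right 0) g = (SUP v\<in>{0<..}. g v)"
    by (intro tendsto_Lim) auto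
  then show ?thesis
    using True by (auto simp: perspective_def g_def SUP_le_iff)
next
  case False
  then have w: "0 < w"
    using w by simp
  have "w * f (x / w) \<le> t" if *: "\<forall>e>0. (w + e) * f (x / (w + e)) \<le> t"
  proof (rule tendsto_upperbound)
    have "isCont f (x / w)"
      using convex_on_continuous[OF open_UNIV f(1)]
      by (simp add: continuous_on_eq_continuous_at)
    moreover have "((\<lambda>e. x / (w + e)) \<longlongrightarrow> x / (w + 0)) (at_right 0)"
      using w by (intro tendsto_intros) auto
    ultimately have "((\<lambda>e. f (x / (w + e))) \<longlongrightarrow> f (x / w)) (at_right 0)"
      by (intro isCont_tendsto_compose[of _ f]) auto
    then have "((\<lambda>e. (w + e) * f (x / (w + e))) \<longlongrightarrow> (w + 0) * f (x / w)) (at_right 0)"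
      by (intro tendsto_intros)
    then show "((\<lambda>e. (w + e) * f (x / (w + e))) \<longlongrightarrow> w * f (x / w)) (at_right 0)"
      by simp
    show "eventually (\<lambda>e. (w + e) * f (x / (w + e)) \<le> t) (at_right 0)"
      unfolding eventually_at_right_field using * by (auto intro: exI[of _ 1])
  qed auto
  moreover have "(w + e) * f (x / (w + e)) \<le> t" if "w * f (x / w) \<le> t" "0 < e" for e
    using perspective_antimono[OF f w, of "w + e" x] that by simp
  ultimately show ?thesis
    using False by (auto simp: perspective_def)
qed

lemma closed_perspective_epigraph:
  fixes f :: "real \<Rightarrow> real"
  assumes f: "convex_on UNIV f" "f 0 = 0"
  shows "closed {(w, x, t). 0 \<le> w \<and> perspective f w x \<le> ereal t}"
proof -
  have cont: "continuous_on UNIV f"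
    using convex_on_continuous[OF open_UNIV f(1)] .
  \<comment> \<open>The maximum with \<open>0\<close> makes the function continuous on the whole space.\<close>
  have "closed {p :: real \<times> real \<times> real. (max (fst p) 0 + e)
      * f (fst (snd p) / (max (fst p) 0 + e)) \<le> snd (snd p)}" if "0 < e" for e
  proof (intro closed_Collect_le continuous_intros continuous_on_compose2[OF cont])
    show "\<forall>p\<in>UNIV. max (fst p) 0 + e \<noteq> 0"
      using that by (auto simp: max_def)
  qed auto
  then have "closed ({p :: real \<times> real \<times> real. 0 \<le> fst p} \<inter>
      (\<Inter>e\<in>{0<..}. {p. (max (fst p) 0 + e) * f (fst (snd p) / (max (fst p) 0 + e)) \<le> snd (snd p)}))"
    by (intro closed_Int closed_INT closed_Collect_le continuous_intros) auto
  also have "\<dots> = {(w, x, t). 0 \<le> w \<and> perspective f w x \<le> ereal t}"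
    by (auto simp: perspective_le_iff[OF f] max_absorb1)
  finally show ?thesis .
qed

lemma convex_perspective_epigraph:
  fixes f :: "real \<Rightarrow> real"
  assumes f: "convex_on UNIV f" "f 0 = 0"
  shows "convex {(w, x, t). 0 \<le> w \<and> perspective f w x \<le> ereal t}"
proof (rule convexI)
  fix p q :: "real \<times> real \<times> real" and a b :: real
  assume p: "p \<in> {(w, x, t). 0 \<le> w \<and> perspective f w x \<le> ereal t}"
    and q: "q \<in> {(w, x, t). 0 \<le> w \<and> perspective f w x \<le> ereal t}"
    and ab: "0 \<le> a" "0 \<le> b" "a + b = 1"
  obtain w1 x1 t1 w2 x2 t2 where pq: "p = (w1, x1, t1)" "q = (w2, x2, t2)"
    by (cases p, cases q) auto
  have w: "0 \<le> w1" "0 \<le> w2" "0 \<le> a * w1 + b * w2"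
    using p q pq ab by auto
  have "(a * w1 + b * w2 + e) * f ((a * x1 + b * x2) / (a * w1 + b * w2 + e)) \<le> a * t1 + b * t2"
    if e: "0 < e" for e
  proof -
    have "a * (w1 + e) + b * (w2 + e) = a * w1 + b * w2 + (a + b) * e"
      by (simp add: algebra_simps)
    then have eq: "a * (w1 + e) + b * (w2 + e) = a * w1 + b * w2 + e"
      using ab(3) by simp
    have "(w1 + e) * f (x1 / (w1 + e)) \<le> t1" "(w2 + e) * f (x2 / (w2 + e)) \<le> t2"
      using p q e unfolding pq by (auto simp: perspective_le_iff[OF f])
    then have "a * ((w1 + e) * f (x1 / (w1 + e))) + b * ((w2 + e) * f (x2 / (w2 + e)))
        \<le> a * t1 + b * t2"
      using ab by (intro add_mono mult_left_mono)
    then show ?thesis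
      using perspective_convex_combination[OF f(1), of "w1 + e" "w2 + e" a b x1 x2] w e ab
      unfolding eq by simp
  qed
  then show "a *\<^sub>R p + b *\<^sub>R q \<in> {(w, x, t). 0 \<le> w \<and> perspective f w x \<le> ereal t}"
    using w unfolding pq by (auto simp: perspective_le_iff[OF f])
qed

section \<open>Binary points with a coordinate equal to one outside a given index\<close>

lemma unit_box_eq_hull_binary:
  "{z :: real ^ 'n. \<forall>i. z $ i \<in> {0..1}} = convex hull {z. \<forall>i. z $ i \<in> {0, 1}}"
proof -
  have "(One :: real ^ 'n) $ i = 1" for i
    using inner_sum_left_Basis[of "axis i 1 :: real ^ 'n" "\<lambda>_. 1"] by (simp add: inner_axis)
  then have box: "cbox 0 (One :: real ^ 'n) = {z. \<forall>i. z $ i \<in> {0..1}}"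
    by (auto simp: mem_box_cart)
  have "(\<forall>b\<in>Basis. z \<bullet> b = 0 \<or> z \<bullet> b = 1) \<longleftrightarrow> (\<forall>i. z $ i \<in> {0, 1})" for z :: "real ^ 'n"
    by (auto simp: Basis_vec_def inner_axis)
  then show ?thesis
    using unit_interval_convex_hull[where 'a = "real ^ 'n"] unfolding box by simp
qed

text \<open>
  A randomised rounding argument. Choose \<open>k \<noteq> l\<close> with probability \<open>y k = z $ k / w\<close>, set
  coordinate \<open>k\<close> to one, and every other coordinate \<open>i\<close> to one with the probability \<open>q i\<close> that
  makes the total probability of a one equal to
  \<open>y i + (1 - y i) * q i = z $ i\<close>. For fixed \<open>k\<close>, the mean \<open>u k\<close> is in the face \<open>v $ k = 1\<close> of
  the unit box, so it is a combination of binary points of this face.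
\<close>

lemma cover_polytope_subset_hull:
  fixes z :: "real ^ 'n" and l :: 'n
  assumes z: "\<forall>i. z $ i \<in> {0..1}" and w: "1 \<le> (\<Sum>i\<in>UNIV - {l}. z $ i)"
  shows "z \<in> convex hull {z. (\<forall>i. z $ i \<in> {0, 1}) \<and> (\<exists>k. k \<noteq> l \<and> z $ k = 1)}"
    (is "_ \<in> convex hull ?B")
proof -
  define w where "w = (\<Sum>i\<in>UNIV - {l}. z $ i)"
  have w1: "1 \<le> w"
    using assms w_def by simp
  define y where "y i = (if i = l then 0 else z $ i / w)" for i
  have yl: "y l = 0"
    by (simp add: y_def)
  define q where "q i = (z $ i - y i) / (1 - y i)" for i
  define u :: "'n \<Rightarrow> real ^ 'n" where "u k = (\<chi> i. if i = k then 1 else q i)" for k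
  have zi: "0 \<le> z $ i" "z $ i \<le> 1" for i
    using z by auto
  have yz: "0 \<le> y i" "y i \<le> z $ i" for i
    using w1 zi[of i] mult_left_mono[of 1 w "z $ i"] by (auto simp: y_def field_simps)
  have q01: "0 \<le> q i" "q i \<le> 1" for i
    using yz[of i] zi[of i] by (auto simp: q_def divide_le_eq_1)
  have u_mem: "u k \<in> convex hull ?B" if "k \<noteq> l" for k
  proof -
    \<comment> \<open>Setting coordinate \<open>k\<close> to one is an affine map that sends the binary points into \<open>?B\<close>,
        hence the whole unit box into the hull of \<open>?B\<close>.\<close>
    define T :: "real ^ 'n \<Rightarrow> real ^ 'n" where "T v = (\<chi> i. if i = k then 1 else v $ i)" for v
    have "convex (T -` (convex hull ?B))"
    proof (rule convexI)
      fix x y :: "real ^ 'n" and a b :: real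
      assume *: "x \<in> T -` (convex hull ?B)" "y \<in> T -` (convex hull ?B)"
        "0 \<le> a" "0 \<le> b" "a + b = 1"
      then have "a *\<^sub>R T x + b *\<^sub>R T y \<in> convex hull ?B"
        by (intro convexD[OF convex_convex_hull]) auto
      moreover have "a *\<^sub>R T x + b *\<^sub>R T y = T (a *\<^sub>R x + b *\<^sub>R y)"
        using \<open>a + b = 1\<close> by (auto simp: T_def vec_eq_iff)
      ultimately show "a *\<^sub>R x + b *\<^sub>R y \<in> T -` (convex hull ?B)"
        by simp
    qed
    moreover have "{v. \<forall>i. v $ i \<in> {0, 1}} \<subseteq> T -` (convex hull ?B)"
    proof
      fix v :: "real ^ 'n" assume "v \<in> {v. \<forall>i. v $ i \<in> {0, 1}}"
      then have "T v \<in> ?B"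
        using that by (auto simp: T_def)
      then show "v \<in> T -` (convex hull ?B)"
        by (simp add: hull_inc)
    qed
    ultimately have "convex hull {v. \<forall>i. v $ i \<in> {0, 1}} \<subseteq> T -` (convex hull ?B)"
      by (intro hull_minimal)
    moreover have "u k \<in> {v. \<forall>i. v $ i \<in> {0..1}}"
      using q01 by (auto simp: u_def)
    ultimately have "T (u k) \<in> convex hull ?B"
      unfolding unit_box_eq_hull_binary by auto
    moreover have "T (u k) = u k"
      by (auto simp: T_def u_def vec_eq_iff)
    ultimately show ?thesis
      by simp
  qed
  have y_sum: "(\<Sum>k\<in>UNIV - {l}. y k) = 1"
    using w1 by (simp add: y_def w_def flip: sum_divide_distrib)
  have "(\<Sum>k\<in>UNIV - {l}. y k *\<^sub>R u k) \<in> convex hull ?B"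
    using y_sum yz u_mem by (intro convex_sum) auto
  moreover have "(\<Sum>k\<in>UNIV - {l}. y k *\<^sub>R u k) = z"
  proof -
    have "(\<Sum>k\<in>UNIV - {l}. y k * u k $ i) = z $ i" for i
    proof -
      have "y k * u k $ i = y k * q i + (if k = i then y i * (1 - q i) else 0)" for k
        by (auto simp: u_def algebra_simps)
      then have "(\<Sum>k\<in>UNIV - {l}. y k * u k $ i)
          = q i + (if i = l then 0 else y i * (1 - q i))"
        using y_sum by (simp add: sum.distrib flip: sum_distrib_right)
      also have "\<dots> = y i + (1 - y i) * q i"
        using yl by (cases "i = l") (simp_all add: algebra_simps)
      also have "\<dots> = z $ i"
        \<comment> \<open>If \<open>y i = 1\<close> then \<open>z $ i = 1\<close>, and the value \<open>q i = 0\<close> of the division by zero fits.\<close>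
        using yz[of i] zi[of i] by (cases "y i = 1") (auto simp: q_def)
      finally show ?thesis .
    qed
    then show ?thesis
      by (simp add: vec_eq_iff)
  qed
  ultimately show ?thesis
    by simp
qed

section \<open>The closed convex hull of the mixed-binary set\<close>

text \<open>
  A convex combination with small weight \<open>e\<close> on a point \<open>(1, d / e, 0)\<close> moves a point by almost
  exactly \<open>(0, d, 0)\<close>.
\<close>

lemma closure_hull_add_orthogonal:
  fixes h :: "real ^ 'n"
  assumes ones: "(\<chi> i. 1) \<in> Q" and f0: "f 0 = 0" and d: "h \<bullet> d = 0"
    and c: "c \<in> closure (convex hull (Z_set f h Q))"
  shows "c + (0, d, 0) \<in> closure (convex hull (Z_set f h Q))" (is "_ \<in> ?C")
proof -
  define p where "p e = ((\<chi> i. 1) :: real ^ 'n, d /\<^sub>R e, 0 :: real)" for e :: real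
  have "p e \<in> ?C" for e
    using ones f0 d
    by (intro subsetD[OF closure_subset] hull_inc) (simp add: p_def Z_set_def)
  then have "(1 - e) *\<^sub>R c + e *\<^sub>R p e \<in> ?C" if "0 < e" "e < 1" for e
    using that c by (intro convexD[OF convex_closure[OF convex_convex_hull]]) auto
  then have ev: "eventually (\<lambda>e. (1 - e) *\<^sub>R c + e *\<^sub>R ((\<chi> i. 1), 0, 0) + (0, d, 0) \<in> ?C) (at_right 0)"
    unfolding eventually_at_right_field
    by (auto intro!: exI[of _ 1] simp: p_def algebra_simps)
  have "((\<lambda>e. (1 - e) *\<^sub>R c + e *\<^sub>R ((\<chi> i. 1), 0, 0) + (0, d, 0))
      \<longlongrightarrow> (1 - 0) *\<^sub>R c + 0 *\<^sub>R ((\<chi> i. 1), 0, 0) + (0, d, 0)) (at_right (0 :: real))"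
    by (intro tendsto_intros)
  then have lim: "((\<lambda>e. (1 - e) *\<^sub>R c + e *\<^sub>R ((\<chi> i. 1), 0, 0) + (0, d, 0))
      \<longlongrightarrow> c + (0, d, 0)) (at_right (0 :: real))"
    by (simp only: diff_zero scaleR_one scaleR_zero_left add_0_right)
  show ?thesis
    by (rule Lim_in_closed_set[OF closed_closure ev trivial_limit_at_right_real lim])
qed

lemma binary_mem_closure_hull:
  fixes h :: "real ^ 'n"
  assumes ones: "(\<chi> i. 1) \<in> Q" and f0: "f 0 = 0" and hk: "h $ k \<noteq> 0"
    and z: "z \<in> Q" "z $ k = 1" and t: "f (h \<bullet> \<beta>) \<le> t"
  shows "(z, \<beta>, t) \<in> closure (convex hull (Z_set f h Q))"
proof -
  \<comment> \<open>The vector supported on \<open>k\<close> with the same inner product with \<open>h\<close>.\<close>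
  define b where "b = axis k (h \<bullet> \<beta> / h $ k)"
  have hb: "h \<bullet> b = h \<bullet> \<beta>"
    using hk by (simp add: b_def inner_axis)
  then have "(z, b, t) \<in> Z_set f h Q"
    using z t by (auto simp: Z_set_def b_def axis_def)
  then have "(z, b, t) \<in> closure (convex hull (Z_set f h Q))"
    by (intro subsetD[OF closure_subset] hull_inc)
  then have "(z, b, t) + (0, \<beta> - b, 0) \<in> closure (convex hull (Z_set f h Q))"
    using hb by (intro closure_hull_add_orthogonal[where f = f, OF ones f0]) (auto simp: inner_diff_right)
  then show ?thesis
    by simp
qed

lemma ones_mem_Q_wh:
  assumes "CARD('n) \<ge> 2"
  shows "(\<chi> i. 1) \<in> Q_wh (l :: 'n::finite)"
  using assms by (simp add: Q_wh_def card_Diff_singleton)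

lemma binary_mem_Q_wh:
  assumes z: "\<forall>i. z $ i \<in> {0, 1}" and k: "k \<noteq> l" "z $ k = 1"
  shows "z \<in> Q_wh l"
proof -
  have "z $ l \<le> z $ k"
    using z k by (metis insert_iff singletonD order_refl zero_le_one)
  also have "\<dots> \<le> (\<Sum>i\<in>UNIV - {l}. z $ i)"
    using z k by (intro member_le_sum) (auto, metis order_refl zero_le_one)
  finally show ?thesis
    using z by (simp add: Q_wh_def)
qed

lemma closure_hull_Z_wh_if_ge_1:
  fixes h :: "real ^ 'n" and l :: 'n
  assumes p2: "CARD('n) \<ge> 2" and h: "\<And>i. h $ i \<noteq> 0" and f0: "f 0 = 0"
    and z: "\<forall>i. z $ i \<in> {0..1}" and w: "1 \<le> (\<Sum>i\<in>UNIV - {l}. z $ i)"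
    and t: "f (h \<bullet> \<beta>) \<le> t"
  shows "(z, \<beta>, t) \<in> closure (convex hull (Z_set f h (Q_wh l)))" (is "_ \<in> ?C")
proof -
  define K where "K = {z. (z, \<beta>, t) \<in> ?C}"
  have "convex K"
  proof (rule convexI)
    fix x y :: "real ^ 'n" and a b :: real
    assume *: "x \<in> K" "y \<in> K" "0 \<le> a" "0 \<le> b" "a + b = 1"
    then have "a *\<^sub>R (x, \<beta>, t) + b *\<^sub>R (y, \<beta>, t) \<in> ?C"
      by (intro convexD[OF convex_closure[OF convex_convex_hull]]) (auto simp: K_def)
    moreover have "a *\<^sub>R \<beta> + b *\<^sub>R \<beta> = \<beta>" "a * t + b * t = t"
      using \<open>a + b = 1\<close> by (metis scaleR_add_left scaleR_one, metis distrib_right mult_1)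
    ultimately show "a *\<^sub>R x + b *\<^sub>R y \<in> K"
      by (simp add: K_def)
  qed
  moreover have "{z. (\<forall>i. z $ i \<in> {0, 1}) \<and> (\<exists>k. k \<noteq> l \<and> z $ k = 1)} \<subseteq> K"
  proof clarify
    fix v :: "real ^ 'n" and k
    assume v: "\<forall>i. v $ i \<in> {0, 1}" "k \<noteq> l" "v $ k = 1"
    have "(v, \<beta>, t) \<in> ?C"
      by (rule binary_mem_closure_hull[where f = f and h = h and k = k])
        (use ones_mem_Q_wh[OF p2] f0 h t v binary_mem_Q_wh[OF v] in auto)
    then show "v \<in> K"
      by (simp add: K_def)
  qed
  ultimately have "convex hull {z. (\<forall>i. z $ i \<in> {0, 1}) \<and> (\<exists>k. k \<noteq> l \<and> z $ k = 1)} \<subseteq> K"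
    by (intro hull_minimal)
  then show ?thesis
    using cover_polytope_subset_hull[OF z w] by (auto simp: K_def)
qed

text \<open>
  The bounds \<open>z $ i \<le> w\<close>, for \<open>i = l\<close> the inequality defining \<open>Q_wh l\<close>, are what keeps \<open>z / w\<close> in
  the unit box.
\<close>

lemma closure_hull_Z_wh_if_less_1:
  fixes h :: "real ^ 'n" and l :: 'n
  assumes p2: "CARD('n) \<ge> 2" and h: "\<And>i. h $ i \<noteq> 0" and f0: "f 0 = 0"
    and z: "\<forall>i. z $ i \<in> {0..1}" and zl: "z $ l \<le> w"
    and w_eq: "w = (\<Sum>i\<in>UNIV - {l}. z $ i)" and w: "0 < w" "w < 1"
    and t: "w * f (h \<bullet> \<beta> / w) \<le> t"
  shows "(z, \<beta>, t) \<in> closure (convex hull (Z_set f h (Q_wh l)))" (is "_ \<in> ?C")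
proof -
  have zw: "z $ i \<le> w" for i
  proof (cases "i = l")
    case False
    then show ?thesis
      unfolding w_eq using z by (intro member_le_sum) auto
  qed (use zl in simp)
  have "(z /\<^sub>R w, \<beta> /\<^sub>R w, t / w) \<in> ?C"
  proof (rule closure_hull_Z_wh_if_ge_1[where f = f, OF p2 h f0])
    show "\<forall>i. (z /\<^sub>R w) $ i \<in> {0..1}"
    proof
      fix i
      have "inverse w * z $ i \<le> inverse w * w"
        using zw w by (intro mult_left_mono) auto
      then show "(z /\<^sub>R w) $ i \<in> {0..1}"
        using z w by simp
    qed
    have "(\<Sum>i\<in>UNIV - {l}. (z /\<^sub>R w) $ i) = inverse w * (\<Sum>i\<in>UNIV - {l}. z $ i)"
      by (simp only: vector_scaleR_component real_scaleR_def sum_distrib_left)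
    also have "\<dots> = 1"
      using w(1) by (simp flip: w_eq)
    finally have "(\<Sum>i\<in>UNIV - {l}. (z /\<^sub>R w) $ i) = 1" .
    then show "1 \<le> (\<Sum>i\<in>UNIV - {l}. (z /\<^sub>R w) $ i)"
      by simp
    have "h \<bullet> (\<beta> /\<^sub>R w) = h \<bullet> \<beta> / w"
      by (simp only: inner_scaleR_right divide_inverse mult.commute)
    moreover have "f (h \<bullet> \<beta> / w) \<le> t / w"
      unfolding pos_le_divide_eq[OF w(1)] using t by (simp only: mult.commute)
    ultimately show "f (h \<bullet> (\<beta> /\<^sub>R w)) \<le> t / w"
      by simp
  qed
  moreover have "(0, 0, 0) \<in> ?C"
    using f0 by (intro subsetD[OF closure_subset] hull_inc) (auto simp: Z_set_def Q_wh_def)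
  ultimately have "w *\<^sub>R (z /\<^sub>R w, \<beta> /\<^sub>R w, t / w) + (1 - w) *\<^sub>R (0, 0, 0) \<in> ?C"
    using w by (intro convexD[OF convex_closure[OF convex_convex_hull]]) auto
  then show ?thesis
    using w by simp
qed

theorem proposition7:
  fixes h :: "real ^ 'n" and f :: "real \<Rightarrow> real" and l :: 'n
  assumes "CARD('n) \<ge> 2"
    and "\<And>i. h $ i \<noteq> 0"
    and "convex_on UNIV f"
    and "f 0 = 0"
  shows "closure (convex hull (Z_set f h (Q_wh l))) =
    {(z, \<beta>, t). (\<forall>i. z $ i \<in> {0..1}) \<and>
       f (h \<bullet> \<beta>) \<le> t \<and>
       z $ l \<le> (\<Sum>i\<in>UNIV - {l}. z $ i) \<and>
       perspective f (\<Sum>i\<in>UNIV - {l}. z $ i) (h \<bullet> \<beta>) \<le> ereal t}"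
    (is "?C = ?R")
proof
  let ?w = "\<lambda>z :: real ^ 'n. \<Sum>i\<in>UNIV - {l}. z $ i"
  let ?g = "\<lambda>p :: (real ^ 'n) \<times> (real ^ 'n) \<times> real. (?w (fst p), h \<bullet> fst (snd p), snd (snd p))"
  let ?E = "{(w, x, t). 0 \<le> w \<and> perspective f w x \<le> ereal t}"
  have cont: "continuous_on UNIV f"
    using convex_on_continuous[OF open_UNIV assms(3)] .
  have lin: "linear ?g"
    by (intro linearI) (auto simp: sum.distrib inner_add_right sum_distrib_left)
  have R_eq: "?R = {p. \<forall>i. fst p $ i \<in> {0..1}} \<inter> {p. f (h \<bullet> fst (snd p)) \<le> snd (snd p)}
      \<inter> {p. fst p $ l \<le> ?w (fst p)} \<inter> ?g -` ?E"
    by (auto simp: sum_nonneg)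
  have "closed {p :: (real ^ 'n) \<times> (real ^ 'n) \<times> real. \<forall>i. fst p $ i \<in> {0..1}}"
    unfolding atLeastAtMost_iff
    by (intro closed_Collect_all closed_Collect_conj closed_Collect_le continuous_intros)
  moreover have "closed {p. f (h \<bullet> fst (snd p)) \<le> snd (snd p)}"
    by (intro closed_Collect_le continuous_intros continuous_on_compose2[OF cont]) auto
  moreover have "closed {p :: (real ^ 'n) \<times> (real ^ 'n) \<times> real. fst p $ l \<le> ?w (fst p)}"
    by (intro closed_Collect_le continuous_intros)
  moreover have "closed (?g -` ?E)"
    by (intro closed_vimage closed_perspective_epigraph assms continuous_intros)
  ultimately have closed_R: "closed ?R"
    unfolding R_eq by (intro closed_Int)
  have "convex {p :: (real ^ 'n) \<times> (real ^ 'n) \<times> real. \<forall>i. fst p $ i \<in> {0..1}}"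
    by (intro convexI) (auto intro!: add_nonneg_nonneg mult_nonneg_nonneg convex_bound_le)
  moreover have "convex {p. f (h \<bullet> fst (snd p)) \<le> snd (snd p)}"
  proof (intro convexI; clarsimp simp: inner_add_right)
    fix x y :: "real ^ 'n" and s r a b :: real
    assume *: "f (h \<bullet> x) \<le> s" "f (h \<bullet> y) \<le> r" "0 \<le> a" "0 \<le> b" "a + b = 1"
    then have "f (a *\<^sub>R (h \<bullet> x) + b *\<^sub>R (h \<bullet> y)) \<le> a * f (h \<bullet> x) + b * f (h \<bullet> y)"
      using assms(3) unfolding convex_on_def by blast
    also have "\<dots> \<le> a * s + b * r"
      using * by (intro add_mono mult_left_mono)
    finally show "f (a * (h \<bullet> x) + b * (h \<bullet> y)) \<le> a * s + b * r"
      by simp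
  qed
  moreover have "convex {p :: (real ^ 'n) \<times> (real ^ 'n) \<times> real. fst p $ l \<le> ?w (fst p)}"
    by (intro convexI)
      (auto simp: sum.distrib sum_distrib_left[symmetric] intro!: add_mono mult_left_mono)
  moreover have "convex (?g -` ?E)"
    by (intro convex_linear_vimage lin convex_perspective_epigraph assms)
  ultimately have convex_R: "convex ?R"
    unfolding R_eq by (intro convex_Int)
  have "Z_set f h (Q_wh l) \<subseteq> ?R"
  proof (clarify, intro conjI)
    fix z \<beta> t assume Z: "(z, \<beta>, t) \<in> Z_set f h (Q_wh l)"
    then have bin: "z $ i = 0 \<or> z $ i = 1" and zl: "z $ l \<le> ?w z"
      and t: "f (h \<bullet> \<beta>) \<le> t" and supp: "\<beta> $ i = 0 \<or> z $ i = 1" for i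
      by (auto simp: Z_set_def Q_wh_def)
    show "\<forall>i. z $ i \<in> {0..1}"
      using bin by (metis atLeastAtMost_iff order_refl zero_le_one)
    show "f (h \<bullet> \<beta>) \<le> t" "z $ l \<le> ?w z"
      using t zl by auto
    have nonneg: "0 \<le> z $ i" for i
      using bin[of i] by auto
    show "perspective f (?w z) (h \<bullet> \<beta>) \<le> ereal t"
    proof (cases "\<exists>k. k \<noteq> l \<and> z $ k = 1")
      case True
      then obtain k where k: "k \<noteq> l" "z $ k = 1"
        by blast
      have "z $ k \<le> ?w z"
        using nonneg k by (intro member_le_sum) auto
      then have w: "1 \<le> ?w z"
        using k by simp
      then have "?w z * f (h \<bullet> \<beta> / ?w z) \<le> 1 * f (h \<bullet> \<beta> / 1)"
        by (intro perspective_antimono assms) auto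
      then show ?thesis
        using w t by (simp add: perspective_def)
    next
      case False
      then have "z $ i = 0" if "i \<noteq> l" for i
        using that bin by blast
      then have w: "?w z = 0"
        by simp
      have "z $ l = 0"
        using w zl nonneg[of l] by simp
      then have "z $ i \<noteq> 1" for i
        using False by (cases "i = l") auto
      then have "\<beta> = 0"
        using supp by (simp add: vec_eq_iff)
      then show ?thesis
        using w t assms by (simp add: perspective_le_iff)
    qed
  qed
  then show "?C \<subseteq> ?R"
    by (intro closure_minimal hull_minimal convex_R closed_R)

  show "?R \<subseteq> ?C"
  proof clarify
    fix z \<beta> t
    assume z: "\<forall>i. z $ i \<in> {0..1}" and t: "f (h \<bullet> \<beta>) \<le> t" and zl: "z $ l \<le> ?w z"
      and persp: "perspective f (?w z) (h \<bullet> \<beta>) \<le> ereal t"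
    consider "1 \<le> ?w z" | "0 < ?w z" "?w z < 1" | "?w z = 0"
      using sum_nonneg[of "UNIV - {l}" "\<lambda>i. z $ i"] z by fastforce
    then show "(z, \<beta>, t) \<in> ?C"
    proof cases
      case 1
      then show ?thesis
        using closure_hull_Z_wh_if_ge_1[where f = f, OF assms(1,2,4) z _ t] by blast
    next
      case 2
      then show ?thesis
        using closure_hull_Z_wh_if_less_1[where f = f, OF assms(1,2,4) z zl refl] persp
        by (simp add: perspective_def)
    next
      case 3
      have "z $ i = 0" if "i \<noteq> l" for i
        using 3 that z by (subst (asm) sum_nonneg_eq_0_iff) auto
      moreover have "z $ l = 0"
        using 3 z zl by (auto intro: antisym)
      ultimately have z0: "z = 0"
        by (metis vec_eq_iff zero_index)
      obtain k where k: "k \<noteq> l"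
        using assms(1) by (metis card_2_iff' card_le_Suc0_iff_eq finite not_less_eq_eq numeral_2_eq_2 UNIV_I)
      \<comment> \<open>Lifting coordinate \<open>k\<close> to \<open>e\<close> makes the sum positive, at no cost in \<open>\<beta>\<close> or \<open>t\<close>.\<close>
      have mem: "(axis k e, \<beta>, t) \<in> ?C" if e: "0 < e" "e < 1" for e
      proof (rule closure_hull_Z_wh_if_less_1[where f = f, OF assms(1,2,4)])
        show "\<forall>i. axis k e $ i \<in> {0..1}"
          using e by (auto simp: axis_def)
        show "axis k e $ l \<le> e"
          using e k by (auto simp: axis_def)
        show "e = (\<Sum>i\<in>UNIV - {l}. axis k e $ i)"
          using k by (simp add: axis_def)
        show "e * f (h \<bullet> \<beta> / e) \<le> t"
          using persp 3 e perspective_le_iff[OF assms(3,4), of 0 "h \<bullet> \<beta>" t] by auto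
      qed (use e in auto)
      have "eventually (\<lambda>e. (e *\<^sub>R axis k 1, \<beta>, t) \<in> ?C) (at_right 0)"
        unfolding eventually_at_right_field
        using mem by (auto intro!: exI[of _ 1] simp: axis_def scaleR_vec_def if_distrib cong: if_cong)
      moreover have "((\<lambda>e. (e *\<^sub>R axis k 1, \<beta>, t)) \<longlongrightarrow> (0 *\<^sub>R axis k 1 :: real ^ 'n, \<beta>, t))
          (at_right (0 :: real))"
        by (intro tendsto_intros)
      ultimately have "(0 *\<^sub>R axis k 1 :: real ^ 'n, \<beta>, t) \<in> ?C"
        by (intro Lim_in_closed_set[OF closed_closure]) auto
      then show ?thesis
        using z0 by simp
    qed
  qed
qed

end
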